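(* For $n\in2\mathbb{Z}\setminus\{0\}$ let $\alpha(n)$ be the greatest $k\in\mathbb{N}$ such that $2^k$ divides $n$, and put $$a_n^+=n+\frac{1}{(\alpha(n)+1)^2},\qquad a_n^-=n-\frac{1}{(\alpha(n)+1)^2}.$$ Then the positive discrete set $\{a_n^+\}_{n\in2\mathbb{Z}\setminus\{0\}}\cup\{a_n^-\}_{n\in2\mathbb{Z}\setminus\{0\}}\subset\mathbb{R}$ (each point taken with mass $+1$) is not almost periodic.
   Context: A continuous function $f$ on $\mathbb{R}$ is almost periodic if for every $\varepsilon>0$ the set $\{\tau\in\mathbb{R}:\sup_{x\in\mathbb{R}}|f(x+\tau)-f(x)|<\varepsilon\}$ is relatively dense in $\mathbb{R}$, i.e. there is $R=R(\varepsilon)<\infty$ such that every interval $(c-R,c+R)$ contains an element of this set. A Borel measure $\mu$ on $\mathbb{R}$ is almost periodic (in the weak sense) if for every continuous compactly supported function $\varphi$ on $\mathbb{R}$ the function $x\mapsto\int\varphi(x+t)\,d\mu(t)$ is almost periodic on $\mathbb{R}$. A discrete (locally finite) set $S\subset\mathbb{R}$ is almost periodic if the measure $\sum_{x\in S}\delta_x$ is almost periodic, where $\delta_x$ is the unit mass at $x$. *)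

theory Defs
  imports "HOL-Probability.Giry_Monad"
begin

definition relatively_dense :: "real set \<Rightarrow> bool" where
  "relatively_dense T \<longleftrightarrow> (\<exists>R. \<forall>c. \<exists>\<tau>\<in>{c - R<..<c + R}. \<tau> \<in> T)"

text \<open>The supremum is taken in the extended reals: on \<^typ>\<open>real\<close> it would be unspecified for
  unbounded sets.\<close>

definition almost_period :: "(real \<Rightarrow> complex) \<Rightarrow> real \<Rightarrow> real \<Rightarrow> bool" where
  "almost_period f \<epsilon> \<tau> \<longleftrightarrow> (SUP x. ereal (cmod (f (x + \<tau>) - f x))) < ereal \<epsilon>"

definition almost_periodic :: "(real \<Rightarrow> complex) \<Rightarrow> bool" where
  "almost_periodic f \<longleftrightarrow>
     continuous_on UNIV f \<and> (\<forall>\<epsilon>>0. relatively_dense {\<tau>. almost_period f \<epsilon> \<tau>})"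

text \<open>Intended for Borel measures that are finite on compact sets, so that the integrals below
  exist; the Bochner integral of a non-integrable function is \<open>0\<close>.\<close>

definition almost_periodic_measure :: "real measure \<Rightarrow> bool" where
  "almost_periodic_measure \<mu> \<longleftrightarrow>
     (\<forall>\<phi>::real \<Rightarrow> complex.
        continuous_on UNIV \<phi> \<and> compact (closure {t. \<phi> t \<noteq> 0}) \<longrightarrow>
        almost_periodic (\<lambda>x. \<integral>t. \<phi> (x + t) \<partial>\<mu>))"

definition locally_finite_set :: "real set \<Rightarrow> bool" where
  "locally_finite_set S \<longleftrightarrow> (\<forall>K. compact K \<longrightarrow> finite (S \<inter> K))"

text \<open>The measure \<open>\<Sum>x\<in>S. \<delta>\<^sub>x\<close>: \<^term>\<open>return borel x\<close> is the unit mass at \<open>x\<close>, and the sum of the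
  masses over \<open>S\<close> is written as an integral against the counting measure.\<close>

definition unit_mass_sum :: "real set \<Rightarrow> real measure" where
  "unit_mass_sum S =
     measure_of UNIV (sets borel) (\<lambda>A. \<integral>\<^sup>+x. emeasure (return borel x) A \<partial>count_space S)"

lemma unit_mass_sum_eq_distr: "unit_mass_sum S = distr (count_space S) borel (\<lambda>x. x)"
proof -
  let ?D = "distr (count_space S) (borel :: real measure) (\<lambda>x. x)"
  have eq: "(\<integral>\<^sup>+x. emeasure (return borel x) A \<partial>count_space S) = emeasure ?D A"
    if "A \<in> sets borel" for A :: "real set"
  proof -
    have "(\<integral>\<^sup>+x. emeasure (return borel x) A \<partial>count_space S)
        = (\<integral>\<^sup>+x. indicator (A \<inter> S) x \<partial>count_space S)"
      using that by (intro nn_integral_cong) (auto simp: indicator_def)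
    also have "\<dots> = emeasure (count_space S) (A \<inter> S)"
      by (intro nn_integral_indicator) auto
    also have "\<dots> = emeasure ?D A"
      using that by (simp add: emeasure_distr)
    finally show ?thesis .
  qed
  have "unit_mass_sum S = measure_of UNIV (sets borel) (emeasure ?D)"
    unfolding unit_mass_sum_def
  proof (rule measure_of_eq)
    fix A :: "real set" assume "A \<in> sigma_sets UNIV (sets borel)"
    then have "A \<in> sets borel"
      using sets.sigma_sets_eq[of "borel :: real measure"] by simp
    then show "(\<integral>\<^sup>+x. emeasure (return borel x) A \<partial>count_space S) = emeasure ?D A"
      by (rule eq)
  qed simp
  also have "\<dots> = ?D"
    using measure_of_of_measure[of ?D] by simp
  finally show ?thesis .
qed

definition almost_periodic_set :: "real set \<Rightarrow> bool" where
  "almost_periodic_set S \<longleftrightarrow> almost_periodic_measure (unit_mass_sum S)"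

text \<open>For \<open>n \<noteq> 0\<close>, \<^term>\<open>multiplicity 2 n\<close> is the greatest \<open>k\<close> such that \<open>2 ^ k\<close> divides \<open>n\<close>.\<close>

definition a_plus :: "int \<Rightarrow> real" where
  "a_plus n = of_int n + 1 / (real (multiplicity 2 n) + 1)\<^sup>2"

definition a_minus :: "int \<Rightarrow> real" where
  "a_minus n = of_int n - 1 / (real (multiplicity 2 n) + 1)\<^sup>2"

end

(* Every nonzero even n contributes points within 1/4 of n, so the set meets every interval of
   length 5/2 centred far from 0; but since n = 0 is excluded it has a gap of length 3 around 0.
   A large almost period would have to reproduce that gap far away. *)
theory Submission
  imports Defs
begin

text \<open>Local finiteness leaves only finitely many points of \<open>S\<close> under a tent of
  half-width \<open>d\<close>, so the Bochner integral is an honest finite sum and not the default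
  value 0.\<close>

lemma unit_mass_sum_integral_tent:
  fixes S :: "real set" and d x :: real
  assumes "locally_finite_set S" and "d > 0"
  defines "\<phi> \<equiv> \<lambda>t. complex_of_real (max 0 (1 - \<bar>t\<bar> / d))"
  shows "(\<integral>t. \<phi> (x + t) \<partial>unit_mass_sum S) = (\<Sum>t\<in>{t\<in>S. \<phi> (x + t) \<noteq> 0}. \<phi> (x + t))"
    and "finite {t\<in>S. \<phi> (x + t) \<noteq> 0}"
proof -
  have "{t\<in>S. \<phi> (x + t) \<noteq> 0} \<subseteq> S \<inter> {-x-d..-x+d}"
  proof
    fix t assume t: "t \<in> {t\<in>S. \<phi> (x + t) \<noteq> 0}"
    then have "\<bar>x + t\<bar> < d"
      using \<open>d > 0\<close> by (auto simp: \<phi>_def max_def field_simps split: if_splits)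
    with t show "t \<in> S \<inter> {-x-d..-x+d}" by auto
  qed
  moreover have "finite (S \<inter> {-x-d..-x+d})"
    using assms(1) by (simp add: locally_finite_set_def)
  ultimately show fin: "finite {t\<in>S. \<phi> (x + t) \<noteq> 0}"
    by (rule finite_subset)
  have "(\<lambda>t. \<phi> (x + t)) \<in> borel_measurable borel"
    unfolding \<phi>_def by measurable
  then have "(\<integral>t. \<phi> (x + t) \<partial>unit_mass_sum S) = (\<integral>t. \<phi> (x + t) \<partial>count_space S)"
    unfolding unit_mass_sum_eq_distr by (subst integral_distr) auto
  also have "\<dots> = (\<Sum>t\<in>{t\<in>S. \<phi> (x + t) \<noteq> 0}. \<phi> (x + t))"
    using fin by (rule lebesgue_integral_count_space_finite_support)
  finally show "(\<integral>t. \<phi> (x + t) \<partial>unit_mass_sum S) = (\<Sum>t\<in>{t\<in>S. \<phi> (x + t) \<noteq> 0}. \<phi> (x + t))" .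
qed

text \<open>Integrating a tent of height 1 and half-width \<open>b - a\<close> against the point
  masses gives a function that vanishes on \<open>{-a..a}\<close>, where the tent stays inside the
  gap, and has modulus at least 1 at \<open>- s\<close> for every \<open>s\<close> in
  \<open>S\<close>. An almost period beyond \<open>M\<close> would shift an argument of the first
  kind to one of the second.\<close>

lemma not_almost_periodic_set_if_unrepeated_gap:
  fixes S :: "real set" and a b M :: real
  assumes lf: "locally_finite_set S" and "a < b" and gap: "S \<inter> {-b..b} = {}"
    and dense: "\<And>c. \<bar>c\<bar> > M \<Longrightarrow> \<exists>s\<in>S. \<bar>s - c\<bar> \<le> a"
  shows "\<not> almost_periodic_set S"
proof
  assume ap: "almost_periodic_set S"
  define d where "d = b - a"
  have "d > 0" using \<open>a < b\<close> by (simp add: d_def)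
  define \<phi> where "\<phi> = (\<lambda>t. complex_of_real (max 0 (1 - \<bar>t\<bar> / d)))"
  define f where "f = (\<lambda>x. \<integral>t. \<phi> (x + t) \<partial>unit_mass_sum S)"
  have f_eq: "f x = (\<Sum>t\<in>{t\<in>S. \<phi> (x + t) \<noteq> 0}. \<phi> (x + t))"
    and fin: "finite {t\<in>S. \<phi> (x + t) \<noteq> 0}" for x
    unfolding f_def \<phi>_def by (rule unit_mass_sum_integral_tent[OF lf \<open>d > 0\<close>])+
  have "continuous_on UNIV \<phi>"
    using \<open>d > 0\<close> unfolding \<phi>_def by (intro continuous_intros) auto
  moreover have "{t. \<phi> t \<noteq> 0} \<subseteq> {-d..d}"
    using \<open>d > 0\<close> by (auto simp: \<phi>_def max_def field_simps split: if_splits)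
  then have "compact (closure {t. \<phi> t \<noteq> 0})"
    by (meson bounded_closed_interval bounded_subset compact_closure)
  ultimately have "almost_periodic f"
    using ap by (simp add: almost_periodic_set_def almost_periodic_measure_def f_def)
  then have "relatively_dense {\<tau>. almost_period f 1 \<tau>}"
    by (simp add: almost_periodic_def)
  then obtain R where R: "\<And>c. \<exists>\<tau>\<in>{c - R<..<c + R}. almost_period f 1 \<tau>"
    by (auto simp: relatively_dense_def)
  obtain \<tau> where "\<tau> > M" "\<tau> > 0" and \<tau>: "almost_period f 1 \<tau>"
  proof -
    \<comment> \<open>The centre puts the left end of the interval at
      \<open>\<bar>M\<bar> + 1\<close> or further right, whatever the sign of
      \<open>R\<close>.\<close>
    obtain \<sigma> where \<sigma>: "\<sigma> \<in> {\<bar>R\<bar> + \<bar>M\<bar> + 1 - R<..<\<bar>R\<bar> + \<bar>M\<bar> + 1 + R}" "almost_period f 1 \<sigma>"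
      using R by blast
    then have "\<sigma> > M" "\<sigma> > 0"
      by (simp_all, linarith+)
    with \<sigma> show thesis by (intro that)
  qed
  then have "\<bar>-\<tau>\<bar> > M" by simp
  from dense[OF this] obtain s where s: "s \<in> S" "\<bar>s + \<tau>\<bar> \<le> a" by auto
  \<comment> \<open>Then \<open>x + \<tau> = - s\<close>, while \<open>\<bar>x\<bar> \<le> a\<close>
    because \<open>s\<close> lies within \<open>a\<close> of \<open>- \<tau>\<close>.\<close>
  define x where "x = - s - \<tau>"
  have "\<phi> (x + t) = 0" if "t \<in> S" for t
  proof -
    have "\<bar>t\<bar> > b" using gap that by (force simp: abs_le_iff)
    with s have "\<bar>x + t\<bar> \<ge> d" by (auto simp: x_def d_def)
    then show ?thesis using \<open>d > 0\<close> by (simp add: \<phi>_def field_simps)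
  qed
  then have "f x = 0"
    unfolding f_eq by (intro sum.neutral) auto
  \<comment> \<open>The point \<open>s\<close> sits under the peak of the tent and all other terms
    are nonnegative, so nothing cancels. The bound 1 contradicts the strict inequality in
    \<open>almost_period f 1 \<tau>\<close>.\<close>
  have "1 = (\<Sum>t\<in>{s}. Re (\<phi> (- s + t)))"
    by (simp add: \<phi>_def)
  also have "\<dots> \<le> (\<Sum>t\<in>{t\<in>S. \<phi> (- s + t) \<noteq> 0}. Re (\<phi> (- s + t)))"
    using s by (intro sum_mono2 fin) (auto simp: \<phi>_def)
  also have "\<dots> = Re (f (- s))"
    unfolding f_eq by (simp add: Re_sum)
  also have "\<dots> \<le> cmod (f (- s))"
    by (rule complex_Re_le_cmod)
  also have "\<dots> = cmod (f (x + \<tau>) - f x)"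
    using \<open>f x = 0\<close> by (simp add: x_def)
  finally have "ereal 1 \<le> ereal (cmod (f (x + \<tau>) - f x))" by simp
  also have "\<dots> \<le> (SUP x. ereal (cmod (f (x + \<tau>) - f x)))"
    by (rule SUP_upper) simp
  finally show False
    using \<tau> by (simp add: almost_period_def)
qed

text \<open>Evenness makes the multiplicity at least 1. At \<open>n = 0\<close> the bound fails,
  since \<open>multiplicity 2 0\<close> is 0 by convention.\<close>

lemma inverse_Suc_multiplicity_two_square_le:
  fixes n :: int
  assumes "even n" and "n \<noteq> 0"
  shows "1 / (real (multiplicity 2 n) + 1)\<^sup>2 \<le> 1 / 4"
proof -
  have "multiplicity 2 n \<ge> 1"
    using assms by (intro multiplicity_geI) auto
  then have "(2::real)\<^sup>2 \<le> (real (multiplicity 2 n) + 1)\<^sup>2"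
    by (intro power_mono) auto
  then show ?thesis
    by (intro divide_left_mono) auto
qed

lemma a_plus_close: "even n \<Longrightarrow> n \<noteq> 0 \<Longrightarrow> \<bar>a_plus n - of_int n\<bar> \<le> 1 / 4"
  using inverse_Suc_multiplicity_two_square_le by (simp add: a_plus_def)

lemma a_minus_close: "even n \<Longrightarrow> n \<noteq> 0 \<Longrightarrow> \<bar>a_minus n - of_int n\<bar> \<le> 1 / 4"
  using inverse_Suc_multiplicity_two_square_le by (simp add: a_minus_def)

text \<open>A value in a set bounded by \<open>B\<close> can only come from an integer of modulus at
  most \<open>B + C\<close>.\<close>

lemma locally_finite_set_if_close_to_int:
  fixes g :: "int \<Rightarrow> real"
  assumes close: "\<And>n. n \<in> N \<Longrightarrow> \<bar>g n - of_int n\<bar> \<le> C"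
  shows "locally_finite_set (g ` N)"
  unfolding locally_finite_set_def
proof (intro allI impI)
  fix K :: "real set"
  assume "compact K"
  then obtain B where B: "\<And>x. x \<in> K \<Longrightarrow> \<bar>x\<bar> \<le> B"
    using compact_imp_bounded[of K] by (auto simp: bounded_iff)
  have "g ` N \<inter> K \<subseteq> g ` {\<lfloor>- (B + C)\<rfloor>..\<lceil>B + C\<rceil>}"
  proof
    fix x assume "x \<in> g ` N \<inter> K"
    then obtain n where n: "n \<in> N" "x = g n" "x \<in> K" by auto
    then have "\<bar>real_of_int n\<bar> \<le> B + C"
      using B[of x] close[of n] by linarith
    then have "n \<in> {\<lfloor>- (B + C)\<rfloor>..\<lceil>B + C\<rceil>}"
      unfolding atLeastAtMost_iff by linarith
    then show "x \<in> g ` {\<lfloor>- (B + C)\<rfloor>..\<lceil>B + C\<rceil>}"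
      using n by auto
  qed
  then show "finite (g ` N \<inter> K)"
    by (rule finite_subset) simp
qed

text \<open>Local finiteness is asserted as well: it is what makes the set discrete, and it keeps
  the integrals behind \<open>almost_periodic_set\<close> from being default values.\<close>

theorem mainTheorem6:
  shows "locally_finite_set ({a_plus n |n. even n \<and> n \<noteq> 0} \<union> {a_minus n |n. even n \<and> n \<noteq> 0})
    \<and> \<not> almost_periodic_set ({a_plus n |n. even n \<and> n \<noteq> 0} \<union> {a_minus n |n. even n \<and> n \<noteq> 0})"
    (is "locally_finite_set ?S \<and> _")
proof -
  let ?N = "{n::int. even n \<and> n \<noteq> 0}"
  have S: "?S = a_plus ` ?N \<union> a_minus ` ?N" by auto
  have "locally_finite_set (a_plus ` ?N)" "locally_finite_set (a_minus ` ?N)"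
    using a_plus_close a_minus_close
    by (auto intro!: locally_finite_set_if_close_to_int[where C = "1 / 4"])
  then have lf: "locally_finite_set ?S"
    unfolding S by (simp add: locally_finite_set_def Int_Un_distrib2)
  have close: "\<exists>n\<in>?N. \<bar>s - of_int n\<bar> \<le> 1 / 4" if "s \<in> ?S" for s
    using that a_plus_close a_minus_close by blast
  have "\<not> almost_periodic_set ?S"
  \<comment> \<open>Some even integer is within 1 of \<open>c\<close>, and its point is displaced by
    at most 1/4, whence 5/4. The points nearest to 0 have modulus 2 - 1/4 = 7/4, so 3/2 lies
    strictly between. For \<open>\<bar>c\<bar> > 1\<close> that even integer is not 0.\<close>
  proof (rule not_almost_periodic_set_if_unrepeated_gap[OF lf, where a = "5/4" and b = "3/2" and M = 1])
    have "s \<notin> {-(3/2)..3/2}" if s: "s \<in> ?S" for s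
    proof -
      obtain n where n: "even n" "n \<noteq> 0" "\<bar>s - of_int n\<bar> \<le> 1 / 4"
        using close[OF s] by auto
      then have "n \<ge> 2 \<or> n \<le> -2" by presburger
      with n(3) show ?thesis by auto
    qed
    then show "?S \<inter> {-(3/2)..3/2} = {}" by blast
  next
    fix c :: real assume "\<bar>c\<bar> > 1"
    \<comment> \<open>This rounds \<open>c\<close> to a nearest even integer.\<close>
    define n where "n = 2 * \<lfloor>(c + 1) / 2\<rfloor>"
    have "real_of_int n \<le> c + 1" "c - 1 < real_of_int n"
      using floor_correct[of "(c + 1) / 2"] by (simp_all add: n_def field_simps)
    moreover from this have "n \<noteq> 0" using \<open>\<bar>c\<bar> > 1\<close> by auto
    moreover have "even n" by (simp add: n_def)
    ultimately have "\<bar>a_plus n - c\<bar> \<le> 5/4" "a_plus n \<in> ?S"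
      using a_plus_close[of n] by (linarith, blast)
    then show "\<exists>s\<in>?S. \<bar>s - c\<bar> \<le> 5/4" by blast
  qed simp
  with lf show ?thesis by blast
qed

end
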